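(* For every integer $k>0$, $$\sum_{i_1=0}^\infty \frac{1}{(2i_1+1)^2}\sum_{i_2=0}^{i_1}\frac{1}{(2i_2+1)^2}\cdots\sum_{i_k=0}^{i_{k-1}}\frac{1}{(2i_k+1)^2}=\left(\frac{\pi}{2}\right)^{2k}\frac{E^\star_{2k}}{(2k)!},$$ where $E^\star_{2k}$ denotes the Euler (zig) numbers.
   Context: The Euler numbers $E^\star_{2n}$ (OEIS A000364) are defined by $\sec(x)=\frac{1}{\cos x}=\sum_{n\ge0}E^\star_{2n}\frac{x^{2n}}{(2n)!}$; thus $E^\star_0=1,E^\star_2=1,E^\star_4=5,\dots$ *)

theory Defs
  imports "HOL-Analysis.Analysis"
begin

text \<open>
  \<open>euler_star m\<close> is the \<open>m\<close>-th coefficient of \<open>sec = 1 / cos\<close> as an exponential generating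
  function: 1, 0, 1, 0, 5, 0, 61, \<dots> These are secant numbers without alternating signs; the
  odd-indexed ones vanish (they are not the tangent numbers).
\<close>

definition euler_star :: "nat \<Rightarrow> real" where
  "euler_star m = fact m * fps_nth (1 / fps_cos 1) m"

text \<open>
  \<open>nested_sum j n\<close> is the block of \<open>j\<close> nested sums
  \<open>\<Sum>i\<^sub>1\<le>n. 1/(2i\<^sub>1+1)\<^sup>2 (\<Sum>i\<^sub>2\<le>i\<^sub>1. 1/(2i\<^sub>2+1)\<^sup>2 (\<dots> (\<Sum>i\<^sub>j\<le>i\<^sub>j\<^sub>-\<^sub>1. 1/(2i\<^sub>j+1)\<^sup>2)))\<close>.
\<close>

fun nested_sum :: "nat \<Rightarrow> nat \<Rightarrow> real" where
  "nested_sum 0 n = 1"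
| "nested_sum (Suc j) n = (\<Sum>i=0..n. 1 / (2 * real i + 1)^2 * nested_sum j i)"

lemma euler_star_odd:
  assumes "odd m"
  shows "euler_star m = 0"
proof -
  define S :: "real fps" where "S = 1 / fps_cos 1"
  have S: "S * fps_cos 1 = 1"
    unfolding S_def by (simp add: fps_divide_unit inverse_mult_eq_1)
  have c: "fps_compose (fps_cos (1::real)) (fps_const (-1) * fps_X) = fps_cos 1"
    by (rule fps_ext) (simp add: fps_compose_linear fps_cos_def)
  have "fps_compose (S * fps_cos 1) (fps_const (-1) * fps_X)
      = fps_compose S (fps_const (-1) * fps_X) * fps_cos 1"
    by (subst fps_compose_mult_distrib) (simp_all add: c del: fps_const_neg)
  hence "fps_compose S (fps_const (-1) * fps_X) * fps_cos 1 = S * fps_cos 1"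
    by (simp add: S)
  moreover have "fps_cos (1::real) \<noteq> 0"
    by (metis fps_cos_nth_0 fps_zero_nth zero_neq_one)
  ultimately have "fps_compose S (fps_const (-1) * fps_X) = S"
    by simp
  hence "fps_nth S m = (-1) ^ m * fps_nth S m"
    by (metis fps_compose_linear fps_nth_Abs_fps)
  thus ?thesis
    using assms by (simp add: euler_star_def S_def)
qed

lemma euler_star_sums_sec:
  "\<forall>\<^sub>F x in nhds 0. (\<lambda>n. euler_star (2 * n) * x ^ (2 * n) / fact (2 * n)) sums (1 / cos x)"
proof -
  define S :: "real fps" where "S = 1 / fps_cos 1"
  have "(\<lambda>x::real. 1 / cos x) has_fps_expansion S"
    unfolding S_def by (intro fps_expansion_intros has_fps_expansion_cos) auto
  hence r: "fps_conv_radius S > 0" and ev: "\<forall>\<^sub>F x in nhds 0. eval_fps S x = 1 / cos x"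
    by (auto simp: has_fps_expansion_def)
  have "\<forall>\<^sub>F x in nhds 0. x \<in> eball 0 (fps_conv_radius S)"
    using r by (intro eventually_nhds_in_open) (auto simp: zero_ereal_def)
  thus ?thesis
    using ev
  proof eventually_elim
    case (elim x)
    have "(\<lambda>m. fps_nth S m * x ^ m) sums (1 / cos x)"
      using sums_eval_fps[of x S] elim by (simp add: in_eball_iff zero_ereal_def)
    moreover have "fps_nth S m * x ^ m = 0" if "m \<notin> range (\<lambda>n. 2 * n)" for m
    proof -
      have "odd m" using that by (auto elim: evenE)
      thus ?thesis using euler_star_odd[of m] by (simp add: euler_star_def S_def)
    qed
    ultimately have "(\<lambda>n. fps_nth S (2 * n) * x ^ (2 * n)) sums (1 / cos x)"
      using sums_mono_reindex[of "\<lambda>n::nat. 2 * n" "\<lambda>m. fps_nth S m * x ^ m"]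
      by (simp add: strict_mono_def)
    thus ?case by (simp add: euler_star_def S_def)
  qed
qed

end

theory Submission
  imports Defs "HOL-Complex_Analysis.Cauchy_Integral_Formula"
begin

text \<open>
  The value \<open>nested_sum k n\<close> is the complete homogeneous symmetric polynomial of degree \<open>k\<close> in
  \<open>a\<^sub>0, \<dots>, a\<^sub>n\<close>, where \<open>a\<^sub>i = 1 / (2i + 1)\<^sup>2\<close>, so its generating function in \<open>k\<close> is
  \<open>\<Prod>i\<le>n. 1 / (1 - a\<^sub>i y)\<close>. For \<open>y = x\<^sup>2\<close> this tends to \<open>1 / cos (\<pi>x/2)\<close> by the product formula
  for the cosine, and Tannery's theorem allows passing to the limit coefficientwise. Comparing
  power series coefficients with those of the secant gives the claim.
\<close>

section \<open>Recursion, bounds and limits of the finite nested sums\<close>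

text \<open>Split the monomials of degree \<open>Suc k\<close> by whether the last variable occurs:
  those containing it are that variable times a monomial of degree \<open>k\<close> in the same
  variables.\<close>

lemma nested_sum_Suc_Suc:
  "nested_sum (Suc k) (Suc n) = nested_sum (Suc k) n + 1 / (2 * real (Suc n) + 1)^2 * nested_sum k (Suc n)"
  by simp

lemma nested_sum_nonneg: "nested_sum k n \<ge> 0"
  by (induction k arbitrary: n) (auto intro!: sum_nonneg mult_nonneg_nonneg)

lemma incseq_nested_sum: "incseq (nested_sum k)"
proof (cases k)
  case (Suc j)
  have "nested_sum (Suc j) n \<le> nested_sum (Suc j) (Suc n)" for n
    unfolding nested_sum_Suc_Suc using nested_sum_nonneg[of j "Suc n"]
    by (simp del: nested_sum.simps)
  with Suc show ?thesis
    by (auto intro!: incseq_SucI simp del: nested_sum.simps)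
qed (simp add: incseq_def)

lemma sum_inverse_odd_squares_le: "(\<Sum>i=0..n. 1 / (2 * real i + 1)^2) \<le> 2"
proof -
  \<comment> \<open>The subtracted term makes the induction work: for \<open>i > 0\<close> the
    summand is at most \<open>1 / (i * (i + 1))\<close>, which telescopes.\<close>
  have "(\<Sum>i=0..n. 1 / (2 * real i + 1)^2) \<le> 2 - 1 / (real n + 1)"
  proof (induction n)
    case (Suc n)
    have "1 / (2 * real (Suc n) + 1)^2 \<le> 1 / ((real n + 1) * (real n + 2))"
    proof (rule frac_le)
      show "(real n + 1) * (real n + 2) \<le> (2 * real (Suc n) + 1)^2"
        by (simp add: power2_eq_square algebra_simps)
    qed (auto intro: mult_pos_pos)
    also have "\<dots> = 1 / (real n + 1) - 1 / (real (Suc n) + 1)"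
      by (simp add: field_simps)
    finally show ?case using Suc.IH by simp
  qed simp
  then show ?thesis
    by (smt (verit) divide_nonneg_nonneg of_nat_0_le_iff)
qed

text \<open>Each of the \<open>k\<close> levels of summation costs a factor of at most 2. Being
  uniform in \<open>n\<close>, the bound yields both convergence in \<open>n\<close> and the
  dominating series for Tannery's theorem; it is also the source of the condition
  \<open>\<bar>y\<bar> < 1 / 2\<close> below.\<close>

lemma nested_sum_le: "nested_sum k n \<le> 2 ^ k"
proof (induction k arbitrary: n)
  case (Suc k)
  have "nested_sum (Suc k) n \<le> (\<Sum>i=0..n. 1 / (2 * real i + 1)^2 * 2 ^ k)"
    by (auto intro!: sum_mono mult_left_mono Suc.IH simp del: times_divide_eq_left)
  also have "\<dots> = (\<Sum>i=0..n. 1 / (2 * real i + 1)^2) * 2 ^ k"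
    by (simp add: sum_distrib_right)
  also have "\<dots> \<le> 2 * 2 ^ k"
    by (intro mult_right_mono sum_inverse_odd_squares_le) auto
  finally show ?case by simp
qed simp

definition nested_series :: "nat \<Rightarrow> real" where
  "nested_series k = lim (nested_sum k)"

lemma nested_sum_tendsto: "nested_sum k \<longlonglongrightarrow> nested_series k"
proof -
  have "Bseq (nested_sum k)"
    by (rule incseq_bounded[OF incseq_nested_sum]) (use nested_sum_le in blast)
  then show ?thesis
    unfolding nested_series_def convergent_LIMSEQ_iff[symmetric]
    using Bseq_monoseq_convergent incseq_imp_monoseq incseq_nested_sum by blast
qed

section \<open>Generating function of the finite nested sums\<close>

lemma summable_nested_sum:
  assumes "\<bar>y\<bar> < 1 / 2"
  shows "summable (\<lambda>k. nested_sum k n * y ^ k)"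
proof (rule summable_comparison_test')
  show "summable (\<lambda>k. (2 * \<bar>y\<bar>) ^ k)"
    using assms by (intro summable_geometric) auto
  show "norm (nested_sum k n * y ^ k) \<le> (2 * \<bar>y\<bar>) ^ k" for k
    using nested_sum_le[of k n] nested_sum_nonneg[of k n]
    by (auto simp: abs_mult power_abs power_mult_distrib intro!: mult_right_mono)
qed

text \<open>Multiplying the recursion by powers of \<open>y\<close> and summing gives
  \<open>F (n+1) = F n + a y F (n+1)\<close> with \<open>a\<close> the new variable, so each
  variable contributes one factor \<open>1 - a y\<close>.\<close>

lemma nested_sum_generating_function:
  assumes y: "\<bar>y\<bar> < 1 / 2"
  shows "(\<Sum>k. nested_sum k n * y ^ k) * (\<Prod>i=0..n. 1 - y / (2 * real i + 1)^2) = 1"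
proof (induction n)
  case 0
  \<comment> \<open>The only variable here is \<open>1 / 1^2 = 1\<close>, so the series is
    geometric.\<close>
  have "nested_sum k 0 = 1" for k by (induction k) auto
  then show ?case using y by (simp add: suminf_geometric)
next
  case (Suc n)
  let ?F = "\<lambda>n. \<Sum>k. nested_sum k n * y ^ k"
  let ?a = "1 / (2 * real (Suc n) + 1)^2"
  have split: "?F m = 1 + (\<Sum>k. nested_sum (Suc k) m * y ^ Suc k)" for m
    using suminf_split_head[OF summable_nested_sum[OF y, of m]] by simp
  have s: "summable (\<lambda>k. nested_sum (Suc k) m * y ^ Suc k)" for m
    using summable_nested_sum[OF y, of m] by (subst summable_Suc_iff)
  have "?F (Suc n) = 1 + (\<Sum>k. nested_sum (Suc k) n * y ^ Suc k
      + ?a * y * (nested_sum k (Suc n) * y ^ k))"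
    unfolding split[of "Suc n"] nested_sum_Suc_Suc by (simp add: algebra_simps)
  also have "\<dots> = 1 + (\<Sum>k. nested_sum (Suc k) n * y ^ Suc k) + ?a * y * ?F (Suc n)"
    using suminf_add[OF s[of n] summable_mult[OF summable_nested_sum[OF y, of "Suc n"], of "?a * y"]]
    unfolding suminf_mult[OF summable_nested_sum[OF y]] by simp
  also have "\<dots> = ?F n + ?a * y * ?F (Suc n)"
    by (simp only: split[of n])
  finally have "?F (Suc n) * (1 - y / (2 * real (Suc n) + 1)^2) = ?F n"
    by (simp add: algebra_simps)
  moreover have "(\<Prod>i=0..Suc n. 1 - y / (2 * real i + 1)^2)
      = (1 - y / (2 * real (Suc n) + 1)^2) * (\<Prod>i=0..n. 1 - y / (2 * real i + 1)^2)"
    by simp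
  ultimately show ?case
    using Suc.IH by (simp only: mult.assoc[symmetric])
qed

section \<open>Product formula for the cosine\<close>

text \<open>
  As \<open>cos t = sin (2t) / (2 sin t)\<close>, dividing two sine products leaves the odd-indexed factors.
\<close>

lemma cos_product_formula_real:
  fixes x :: real
  assumes x: "0 < \<bar>x\<bar>" "\<bar>x\<bar> < 1"
  shows "(\<lambda>n. \<Prod>i=0..n. 1 - x^2 / (2 * real i + 1)^2) \<longlonglongrightarrow> cos (pi * x / 2)"
proof -
  define P where "P = (\<lambda>(x::real) n. \<Prod>k=1..n. 1 - x^2 / of_nat k^2)"
  have P: "P x \<longlonglongrightarrow> sin (pi * x) / (pi * x)" if "x \<noteq> 0" for x
    unfolding P_def by (rule sin_product_formula_real'[OF that])
  have sin_nz: "sin (pi * (x / 2)) \<noteq> 0"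
  proof -
    have "sin (pi * (\<bar>x\<bar> / 2)) > 0"
      using x by (intro sin_gt_zero) auto
    then show ?thesis by (cases "x \<ge> 0") auto
  qed
  \<comment> \<open>This allows cancelling in the finite quotients, as \<open>sin_nz\<close> does in
    the limit.\<close>
  have P_half: "P (x / 2) n \<noteq> 0" for n
  proof -
    have "(x / 2)^2 / of_nat k ^ 2 \<noteq> 1" if "k \<ge> 1" for k :: nat
    proof -
      have "(x / 2)\<^sup>2 < 1" using x by (subst abs_square_less_1) auto
      also have "1 \<le> real k ^ 2" using that by simp
      finally show ?thesis using that by (simp add: field_simps)
    qed
    then show ?thesis by (auto simp: P_def)
  qed
  \<comment> \<open>The factor of \<open>P x\<close> at \<open>k = 2 * j\<close> is the factor of
    \<open>P (x / 2)\<close> at \<open>j\<close>. Up to \<open>2 * Suc n\<close> the odd indices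
    left over are \<open>2 * i + 1\<close> with \<open>i \<le> n\<close>.\<close>
  have split: "P x (2 * Suc n) = P (x / 2) (Suc n) * (\<Prod>i=0..n. 1 - x^2 / (2 * real i + 1)^2)" for n
  proof (induction n)
    case 0
    show ?case by (simp add: P_def numeral_2_eq_2 power_divide)
  next
    case (Suc n)
    have "P x (2 * Suc (Suc n)) = P x (2 * Suc n) *
        ((1 - x^2 / (2 * real (Suc n) + 1)^2) * (1 - (x / 2)^2 / real (Suc (Suc n))^2))"
      by (simp add: P_def prod.nat_ivl_Suc' power_divide) (simp add: power2_eq_square field_simps)
    also have "\<dots> = (P (x / 2) (Suc n) * (1 - (x / 2)^2 / real (Suc (Suc n))^2)) *
        ((\<Prod>i=0..n. 1 - x^2 / (2 * real i + 1)^2) * (1 - x^2 / (2 * real (Suc n) + 1)^2))"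
      unfolding Suc.IH by (simp only: mult_ac)
    also have "P (x / 2) (Suc n) * (1 - (x / 2)^2 / real (Suc (Suc n))^2) = P (x / 2) (Suc (Suc n))"
      by (simp add: P_def prod.nat_ivl_Suc' mult.commute)
    also have "(\<Prod>i=0..n. 1 - x^2 / (2 * real i + 1)^2) * (1 - x^2 / (2 * real (Suc n) + 1)^2)
        = (\<Prod>i=0..Suc n. 1 - x^2 / (2 * real i + 1)^2)"
      by simp
    finally show ?case .
  qed
  have "(\<lambda>n. P x (2 * Suc n)) \<longlonglongrightarrow> sin (pi * x) / (pi * x)"
    using x by (intro filterlim_compose[OF P] filterlim_subseq) (auto simp: strict_mono_def)
  moreover have "(\<lambda>n. P (x / 2) (Suc n)) \<longlonglongrightarrow> sin (pi * (x / 2)) / (pi * (x / 2))"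
    using x by (intro LIMSEQ_Suc P) auto
  ultimately have "(\<lambda>n. P x (2 * Suc n) / P (x / 2) (Suc n)) \<longlonglongrightarrow>
      (sin (pi * x) / (pi * x)) / (sin (pi * (x / 2)) / (pi * (x / 2)))"
    using x sin_nz by (intro tendsto_divide) auto
  also have "(sin (pi * x) / (pi * x)) / (sin (pi * (x / 2)) / (pi * (x / 2))) = cos (pi * x / 2)"
    using x sin_nz sin_double[of "pi * (x / 2)"] by (simp add: field_simps)
  finally show ?thesis
    unfolding split using P_half by simp
qed

section \<open>Passage to the limit\<close>

lemma nested_series_sums_sec:
  assumes "\<bar>x\<bar> < 1 / 2"
  shows "(\<lambda>k. nested_series k * x ^ (2 * k)) sums (1 / cos (pi * x / 2))"
\<comment> \<open>The product formula for the cosine is available only for nonzero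
  \<open>x\<close>.\<close>
proof (cases "x = 0")
  case True
  have "nested_series 0 = 1"
  proof (rule LIMSEQ_unique[OF nested_sum_tendsto])
    have "nested_sum 0 = (\<lambda>_. 1)"
      by (simp add: fun_eq_iff)
    then show "nested_sum 0 \<longlonglongrightarrow> 1"
      by simp
  qed
  then show ?thesis
    using True powser_sums_zero[of nested_series] by (simp add: power_mult)
next
  case False
  define y where "y = x ^ 2"
  have "\<bar>x\<bar> ^ 2 < (1 / 2) ^ 2"
    using assms by (intro power_strict_mono) auto
  then have y: "\<bar>y\<bar> < 1 / 2"
    by (simp add: y_def power2_eq_square)
  have "eventually (\<lambda>n. summable (\<lambda>k. norm (nested_sum k n * y ^ k))) sequentially \<and>
    summable (\<lambda>k. norm (nested_series k * y ^ k)) \<and>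
    (\<lambda>n. \<Sum>k. nested_sum k n * y ^ k) \<longlonglongrightarrow> (\<Sum>k. nested_series k * y ^ k)"
  proof (rule tannerys_theorem)
    show "(\<lambda>n. nested_sum k n * y ^ k) \<longlonglongrightarrow> nested_series k * y ^ k" for k
      by (intro tendsto_intros nested_sum_tendsto)
    show "summable (\<lambda>k. (2 * \<bar>y\<bar>) ^ k)"
      using y by (intro summable_geometric) auto
    show "\<forall>\<^sub>F (k, n) in sequentially \<times>\<^sub>F sequentially. norm (nested_sum k n * y ^ k) \<le> (2 * \<bar>y\<bar>) ^ k"
      using nested_sum_le nested_sum_nonneg
      by (auto simp: abs_mult power_abs power_mult_distrib intro!: always_eventually mult_right_mono)
  qed simp
  then have s: "summable (\<lambda>k. nested_series k * y ^ k)"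
    and lim: "(\<lambda>n. \<Sum>k. nested_sum k n * y ^ k) \<longlonglongrightarrow> (\<Sum>k. nested_series k * y ^ k)"
    by (blast intro: summable_norm_cancel)+
  have "(\<lambda>n. (\<Sum>k. nested_sum k n * y ^ k) * (\<Prod>i=0..n. 1 - y / (2 * real i + 1)^2))
      \<longlonglongrightarrow> (\<Sum>k. nested_series k * y ^ k) * cos (pi * x / 2)"
    using False assms unfolding y_def
    by (intro tendsto_mult lim[unfolded y_def] cos_product_formula_real) auto
  then have "(\<Sum>k. nested_series k * y ^ k) * cos (pi * x / 2) = 1"
    unfolding nested_sum_generating_function[OF y] by (simp add: LIMSEQ_const_iff)
  \<comment> \<open>The product being 1 forces the cosine to be nonzero.\<close>
  then have "(\<Sum>k. nested_series k * y ^ k) = 1 / cos (pi * x / 2)"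
    by (metis eq_divide_eq mult_zero_right zero_neq_one)
  with summable_sums[OF s] show ?thesis
    by (simp add: y_def power_mult)
qed

section \<open>Comparison of coefficients\<close>

text \<open>The difference of the two series represents the zero function near 0. With a nonzero
  coefficient, its zero at the origin would be isolated, a contradiction.\<close>

lemma has_fps_expansion_unique:
  fixes f :: "'a::{banach, real_normed_field} \<Rightarrow> 'a"
  assumes "f has_fps_expansion F" "f has_fps_expansion G"
  shows "F = G"
proof (rule ccontr)
  assume "F \<noteq> G"
  define D where "D = F - G"
  obtain m where m: "fps_nth D m \<noteq> 0"
    using \<open>F \<noteq> G\<close> by (auto simp: D_def fps_eq_iff)
  have "(\<lambda>_. 0) has_fps_expansion D"
    using has_fps_expansion_diff[OF assms] by (simp add: D_def)
  then have pos: "fps_conv_radius D > 0" and ev: "\<forall>\<^sub>F z in nhds 0. eval_fps D z = 0"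
    by (auto simp: has_fps_expansion_def)
  have D0: "eval_fps D 0 = 0"
    using ev by (rule eventually_nhds_x_imp_x)
  with m have "m > 0"
    by (cases m) (auto simp: eval_fps_at_0)
  obtain r where r: "0 < r" "ereal r < fps_conv_radius D"
    using ereal_dense2[OF pos] by auto
  have sums: "(\<lambda>n. fps_nth D n * (x - 0) ^ n) sums eval_fps D x" if "norm (x - 0) < r" for x
  proof -
    have "ereal (norm x) < fps_conv_radius D"
      using that by (intro less_trans[OF _ r(2)]) simp
    then show ?thesis by (auto intro!: sums_eval_fps)
  qed
  obtain s where s: "0 < s" "\<And>z. z \<in> cball 0 s - {0} \<Longrightarrow> eval_fps D z \<noteq> 0"
    using powser_0_nonzero[OF r(1) sums D0 m \<open>m > 0\<close>] by metis
  have "\<forall>\<^sub>F z in at 0. z \<in> ball 0 s - {0::'a}"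
    using s(1) by (intro eventually_at_in_open) auto
  moreover have "\<forall>\<^sub>F z in at 0. eval_fps D z = 0"
    using ev by (simp add: eventually_nhds_conv_at)
  ultimately have "\<forall>\<^sub>F z in at (0::'a). False"
    by eventually_elim (use s(2) in force)
  then show False
    by simp
qed

lemma nested_series_eq:
  "nested_series k = (pi / 2) ^ (2 * k) * (euler_star (2 * k) / fact (2 * k))"
proof -
  \<comment> \<open>Substituting \<open>2 / pi * x\<close> for \<open>x\<close> turns
    \<open>1 / cos (pi * x / 2)\<close> into \<open>1 / cos x\<close>; the missing odd powers are
    filled with zeros.\<close>
  define G :: "real fps" where
    "G = Abs_fps (\<lambda>m. if even m then nested_series (m div 2) * (2 / pi) ^ m else 0)"
  have G: "(\<lambda>x::real. 1 / cos x) has_fps_expansion G"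
  proof (rule has_fps_expansionI)
    \<comment> \<open>The radius \<open>pi / 4\<close> is the bound \<open>1 / 2\<close> after this
      rescaling.\<close>
    have "\<forall>\<^sub>F x::real in nhds 0. dist x 0 < pi / 4"
      by (rule eventually_nhds_ball[THEN eventually_mono, of "pi / 4"]) (auto simp: dist_commute)
    then show "\<forall>\<^sub>F x in nhds 0. (\<lambda>n. fps_nth G n * x ^ n) sums (1 / cos x)"
    proof eventually_elim
      case (elim x)
      have "(\<lambda>k. nested_series k * (2 / pi * x) ^ (2 * k)) sums (1 / cos (pi * (2 / pi * x) / 2))"
        using elim by (intro nested_series_sums_sec) (simp add: abs_mult field_simps)
      then have "(\<lambda>k. fps_nth G (2 * k) * x ^ (2 * k)) sums (1 / cos x)"
        by (simp add: G_def power_mult_distrib power_divide mult_ac)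
      then show ?case
        by (subst (asm) sums_mono_reindex[of "\<lambda>k. 2 * k" "\<lambda>n. fps_nth G n * x ^ n"])
           (auto simp: strict_mono_def G_def)
    qed
  qed
  have S: "(\<lambda>x::real. 1 / cos x) has_fps_expansion 1 / fps_cos 1"
    by (intro fps_expansion_intros has_fps_expansion_cos) auto
  have "fps_nth (1 / fps_cos 1) (2 * k) = nested_series k * (2 / pi) ^ (2 * k)"
    unfolding has_fps_expansion_unique[OF S G] by (simp add: G_def)
  then show ?thesis
    by (simp add: euler_star_def power_divide)
qed

theorem theorem4:
  fixes k :: nat
  assumes "k > 0"
  shows "(\<lambda>i. 1 / (2 * real i + 1)^2 * nested_sum (k - 1) i)
    sums ((pi / 2) ^ (2 * k) * (euler_star (2 * k) / fact (2 * k)))"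
proof -
  obtain j where k: "k = Suc j"
    using assms gr0_conv_Suc by blast
  \<comment> \<open>The outermost sum of \<open>nested_sum k n\<close> is the partial sum through
    index \<open>n\<close> inclusive, which is the form used by \<open>sums_def_le\<close>.\<close>
  have "nested_sum k = (\<lambda>n. \<Sum>i\<le>n. 1 / (2 * real i + 1)^2 * nested_sum (k - 1) i)"
    by (simp add: k fun_eq_iff atMost_atLeast0)
  then show ?thesis
    using nested_sum_tendsto[of k] unfolding nested_series_eq sums_def_le by simp
qed

end
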